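(* Let $n=4$ and let $r>1$ be an integer. If $\mathcal{H}_n,\mathcal{H}'_n\in\mathscr{H}_{(n,r)}$ are hearts, with entries $\lambda_{(i,j)}$ and $\lambda'_{(i,j)}$ respectively, such that $\lambda_{(n-1,2)}=\lambda'_{(n-1,2)}$ and $\lambda_{(n-2,1)}=\lambda'_{(n-2,1)}$, then $|T(\mathcal{H}_n)|=|T(\mathcal{H}'_n)|$.
   Context: A Gelfand-Tsetlin pattern (GT-pattern) over $\mathrm{gl}_n$ with top row $\lambda=(\lambda_{(n,1)},\dots,\lambda_{(n,n)})$ (a weakly decreasing integer vector) is a triangular array of integers $\lambda_{(k,i)}$, $1\leq i\leq k\leq n$, whose $n$-th row is $\lambda$ and which satisfies $\lambda_{(k,i)}\geq\lambda_{(k-1,i)}\geq\lambda_{(k,i+1)}$ for all $2\leq k\leq n$, $1\leq i\leq k-1$. For $n\geq 4$, the heart of a GT-pattern is its triangular subarray with corners $\lambda_{(n-1,1)}$, $\lambda_{(n-1,n-2)}$, $\lambda_{(2,1)}$. For $n=4$ it consists of the three entries $\lambda_{(3,1)},\lambda_{(3,2)}$ (upper row) and $\lambda_{(2,1)}$ (lower row). Fix a top row $\lambda$ of length $n$ with consecutive differences $\lambda_{(n,i-1)}-\lambda_{(n,i)}=r$ for $2\leq i\leq n$. Then $\mathscr{H}_{(n,r)}$ denotes the set of all hearts of GT-patterns with top row $\lambda$, and for a heart $\mathcal{H}_n\in\mathscr{H}_{(n,r)}$, $T(\mathcal{H}_n)$ denotes the set of GT-patterns with top row $\lambda$ whose heart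 is $\mathcal{H}_n$. *)

theory Defs
  imports "HOL-Library.FuncSet"
begin

text \<open>Triangular arrays are functions on index pairs \<open>(k, i)\<close> (row, position in the row), both
  counted from 1 and with row \<open>k = n\<close> on top. Arrays take the value \<^term>\<open>undefined\<close> outside their
  index set, so that equality of functions is equality of arrays and cardinalities count arrays.\<close>

definition gt_index :: "nat \<Rightarrow> (nat \<times> nat) set" where
  "gt_index n = {(k, i). 1 \<le> i \<and> i \<le> k \<and> k \<le> n}"

definition gt_patterns :: "nat \<Rightarrow> (nat \<Rightarrow> int) \<Rightarrow> (nat \<times> nat \<Rightarrow> int) set" where
  "gt_patterns n lam = {p \<in> extensional (gt_index n).
     (\<forall>i\<in>{1..n}. p (n, i) = lam i) \<and>
     (\<forall>k\<in>{2..n}. \<forall>i\<in>{1..k-1}. p (k, i) \<ge> p (k-1, i) \<and> p (k-1, i) \<ge> p (k, i+1))}"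

text \<open>The triangle with corners \<open>(n-1, 1)\<close>, \<open>(n-1, n-2)\<close> and \<open>(2, 1)\<close>.\<close>

definition heart_index :: "nat \<Rightarrow> (nat \<times> nat) set" where
  "heart_index n = {(k, i). 2 \<le> k \<and> k \<le> n-1 \<and> 1 \<le> i \<and> i \<le> k-1}"

definition heart :: "nat \<Rightarrow> (nat \<times> nat \<Rightarrow> int) \<Rightarrow> (nat \<times> nat \<Rightarrow> int)" where
  "heart n p = restrict p (heart_index n)"

definition hearts :: "nat \<Rightarrow> (nat \<Rightarrow> int) \<Rightarrow> (nat \<times> nat \<Rightarrow> int) set" where
  "hearts n lam = heart n ` gt_patterns n lam"

definition patterns_with_heart ::
  "nat \<Rightarrow> (nat \<Rightarrow> int) \<Rightarrow> (nat \<times> nat \<Rightarrow> int) \<Rightarrow> (nat \<times> nat \<Rightarrow> int) set" where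
  "patterns_with_heart n lam H = {p \<in> gt_patterns n lam. heart n p = H}"

text \<open>These sets are finite, so \<^const>\<open>card\<close> is a genuine count.\<close>

lemma gt_pattern_entry_bounds:
  assumes p: "p \<in> gt_patterns n lam" and "k \<le> n" "1 \<le> i" "i \<le> k"
  shows "p (k, i) \<in> {Min (lam ` {1..n})..Max (lam ` {1..n})}"
  using assms(2-)
proof (induction k arbitrary: i rule: inc_induct)
  case base
  then have "p (n, i) = lam i" "i \<in> {1..n}"
    using p by (auto simp: gt_patterns_def)
  then show ?case by simp
next
  case (step k)
  have "Suc k \<in> {2..n}" "i \<in> {1..Suc k - 1}"
    using step by auto
  then have "p (Suc k, i) \<ge> p (k, i)" "p (k, i) \<ge> p (Suc k, i + 1)"
    using p unfolding gt_patterns_def by (metis (lifting) diff_Suc_1 mem_Collect_eq)+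
  moreover have "p (Suc k, i) \<in> {Min (lam ` {1..n})..Max (lam ` {1..n})}"
    "p (Suc k, i + 1) \<in> {Min (lam ` {1..n})..Max (lam ` {1..n})}"
    using step.IH step.prems by simp_all
  ultimately show ?case by simp
qed

lemma finite_gt_patterns: "finite (gt_patterns n lam)"
proof (rule finite_subset)
  show "gt_patterns n lam \<subseteq>
      (\<Pi>\<^sub>E x\<in>gt_index n. {Min (lam ` {1..n})..Max (lam ` {1..n})})"
  proof
    fix p assume p: "p \<in> gt_patterns n lam"
    show "p \<in> (\<Pi>\<^sub>E x\<in>gt_index n. {Min (lam ` {1..n})..Max (lam ` {1..n})})"
    proof (rule PiE_I)
      fix x assume "x \<in> gt_index n"
      then show "p x \<in> {Min (lam ` {1..n})..Max (lam ` {1..n})}"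
        using gt_pattern_entry_bounds[OF p] by (cases x) (simp add: gt_index_def)
    next
      fix x assume "x \<notin> gt_index n"
      then show "p x = undefined"
        using p by (cases x) (simp add: gt_patterns_def extensional_def)
    qed
  qed
  have "gt_index n \<subseteq> {..n} \<times> {..n}"
    by (auto simp: gt_index_def)
  then have "finite (gt_index n)"
    by (rule finite_subset) simp
  then show "finite (\<Pi>\<^sub>E x\<in>gt_index n. {Min (lam ` {1..n})..Max (lam ` {1..n})})"
    by (rule finite_PiE) simp
qed

lemma finite_patterns_with_heart: "finite (patterns_with_heart n lam H)"
  unfolding patterns_with_heart_def by (simp add: finite_gt_patterns)

end

theory Submission
  imports Defs
begin

text \<open>The corner entry \<open>(n-1, 1)\<close> of a GT-pattern touches only two entries of the top row, which are
  prescribed, and the entry \<open>(n-2, 1)\<close> below it. Hence the corner may be exchanged freely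
  between two patterns that agree at \<open>(n-2, 1)\<close> (lemma \<open>gt_patterns_swap_corner\<close>).

  For \<open>n = 4\<close> the heart consists of the corner \<open>(3, 1)\<close>, the entry \<open>(3, 2)\<close> and the entry
  \<open>(2, 1)\<close>. Two hearts as in the theorem therefore differ at most in the corner. Overwriting the
  corner by the value in the other heart maps the patterns with one heart injectively into the
  patterns with the other; doing this in both directions gives equal cardinalities.\<close>

text \<open>Indexing the interlacing conditions by the lower row avoids truncated subtraction.\<close>

lemma gt_patterns_iff:
  "p \<in> gt_patterns n lam \<longleftrightarrow>
    p \<in> extensional (gt_index n) \<and> (\<forall>i. 1 \<le> i \<and> i \<le> n \<longrightarrow> p (n, i) = lam i) \<and>
    (\<forall>k i. 1 \<le> i \<and> i \<le> k \<and> Suc k \<le> n \<longrightarrow>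
      p (Suc k, i) \<ge> p (k, i) \<and> p (k, i) \<ge> p (Suc k, Suc i))"
proof -
  have "(\<forall>k\<in>{2..n}. \<forall>i\<in>{1..k-1}. p (k, i) \<ge> p (k-1, i) \<and> p (k-1, i) \<ge> p (k, i+1)) \<longleftrightarrow>
      (\<forall>k i. 1 \<le> i \<and> i \<le> k \<and> Suc k \<le> n \<longrightarrow>
        p (Suc k, i) \<ge> p (k, i) \<and> p (k, i) \<ge> p (Suc k, Suc i))" (is "?L \<longleftrightarrow> ?R")
  proof
    assume L: ?L
    show ?R
    proof (intro allI impI)
      fix k i assume ki: "1 \<le> i \<and> i \<le> k \<and> Suc k \<le> n"
      then have "Suc k \<in> {2..n}" "i \<in> {1..Suc k - 1}" by auto
      from bspec[OF bspec[OF L this(1)] this(2)]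
      show "p (Suc k, i) \<ge> p (k, i) \<and> p (k, i) \<ge> p (Suc k, Suc i)" by simp
    qed
  next
    assume R: ?R
    show ?L
    proof (intro ballI)
      fix k i assume "k \<in> {2..n}" "i \<in> {1..k-1}"
      then show "p (k, i) \<ge> p (k-1, i) \<and> p (k-1, i) \<ge> p (k, i+1)"
        using R[rule_format, of i "k - 1"] by auto
    qed
  qed
  then show ?thesis
    unfolding gt_patterns_def by auto
qed

text \<open>The inequalities at the corner \<open>(n-1, 1)\<close> involve, besides the top row, only \<open>(n-2, 1)\<close>; so they
  hold in the modified pattern because they hold in \<open>q\<close>.\<close>

lemma gt_patterns_swap_corner:
  assumes p: "p \<in> gt_patterns n lam" and q: "q \<in> gt_patterns n lam"
    and n: "2 \<le> n" and eq: "p (n-2, 1) = q (n-2, 1)"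
  shows "p((n-1, 1) := q (n-1, 1)) \<in> gt_patterns n lam" (is "?p' \<in> _")
proof -
  obtain m where m: "n = Suc (Suc m)"
    using n by (metis Suc_le_D numeral_2_eq_2 Suc_le_mono)
  have P: "p (Suc k, i) \<ge> p (k, i)" "p (k, i) \<ge> p (Suc k, Suc i)"
    and Q: "q (Suc k, i) \<ge> q (k, i)" "q (k, i) \<ge> q (Suc k, Suc i)"
    if "1 \<le> i" "i \<le> k" "Suc k \<le> n" for k i
    using p q that unfolding gt_patterns_iff by blast+
  have top: "p (n, i) = lam i" "q (n, i) = lam i" if "1 \<le> i" "i \<le> n" for i
    using p q that unfolding gt_patterns_iff by blast+
  have "?p' \<in> extensional (gt_index n)"
    using p m by (auto simp: gt_patterns_iff extensional_def gt_index_def)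
  moreover have "?p' (n, i) = lam i" if "1 \<le> i" "i \<le> n" for i
    using top(1)[OF that] m by simp
  moreover have "?p' (Suc k, i) \<ge> ?p' (k, i) \<and> ?p' (k, i) \<ge> ?p' (Suc k, Suc i)"
    if ki: "1 \<le> i" "i \<le> k" "Suc k \<le> n" for k i
  proof -
    consider "(k, i) = (Suc m, 1)" | "(Suc k, i) = (Suc m, 1)"
      | "(k, i) \<noteq> (Suc m, 1)" "(Suc k, i) \<noteq> (Suc m, 1)" by blast
    then show ?thesis
    proof cases
      case 1
      then show ?thesis
        using Q[OF ki] top[of 1] top[of 2] m by (simp add: numeral_2_eq_2)
    next
      case 2
      then show ?thesis
        using P[OF ki] Q[OF ki] eq m by simp
    next
      case 3
      then show ?thesis
        using P[OF ki] ki m by auto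
    qed
  qed
  ultimately show ?thesis
    unfolding gt_patterns_iff by blast
qed

lemma heart_index_4: "heart_index 4 = {(3, 1), (3, 2), (2, 1)}"
  by (auto simp: heart_index_def)

lemma card_patterns_with_heart_le:
  assumes "H' \<in> hearts 4 lam" and b: "H (3, 2) = H' (3, 2)" and d: "H (2, 1) = H' (2, 1)"
  shows "card (patterns_with_heart 4 lam H) \<le> card (patterns_with_heart 4 lam H')"
proof -
  obtain q where q: "q \<in> gt_patterns 4 lam" and H': "H' = heart 4 q"
    using assms(1) by (auto simp: hearts_def)
  let ?swap = "\<lambda>p. p((3, 1) := q (3, 1))"
  have into: "?swap ` patterns_with_heart 4 lam H \<subseteq> patterns_with_heart 4 lam H'"
  proof
    fix p' assume "p' \<in> ?swap ` patterns_with_heart 4 lam H"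
    then obtain p where p: "p \<in> gt_patterns 4 lam" and H: "H = heart 4 p" and p': "p' = ?swap p"
      by (auto simp: patterns_with_heart_def)
    have pq: "p (3, 2) = q (3, 2)" "p (2, 1) = q (2, 1)"
      using b d by (simp_all add: H H' heart_def heart_index_4)
    have "p' \<in> gt_patterns 4 lam"
      using gt_patterns_swap_corner[OF p q] pq p' by simp
    moreover have "heart 4 p' = H'"
      unfolding H' heart_def p' heart_index_4 using pq by (auto simp: restrict_def)
    ultimately show "p' \<in> patterns_with_heart 4 lam H'"
      by (simp add: patterns_with_heart_def)
  qed
  \<comment> \<open>The overwritten entry belongs to the heart, so it can be recovered from \<open>H\<close>.\<close>
  have "inj_on ?swap (patterns_with_heart 4 lam H)"
  proof (rule inj_onI)
    fix p1 p2 assume 12: "p1 \<in> patterns_with_heart 4 lam H" "p2 \<in> patterns_with_heart 4 lam H"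
      and eq: "?swap p1 = ?swap p2"
    have "heart 4 p1 (3, 1) = heart 4 p2 (3, 1)"
      using 12 by (simp add: patterns_with_heart_def)
    then have "p1 (3, 1) = p2 (3, 1)"
      by (simp add: heart_def heart_index_4)
    then show "p1 = p2"
      using eq by (metis fun_upd_triv fun_upd_upd)
  qed
  then show ?thesis
    using into finite_patterns_with_heart by (rule card_inj_on_le)
qed

theorem proposition5:
  fixes n :: nat and r :: int and lam :: "nat \<Rightarrow> int" and H H' :: "nat \<times> nat \<Rightarrow> int"
  assumes "n = 4" and "r > 1"
    and "\<forall>i\<in>{2..n}. lam (i-1) - lam i = r"
    and "H \<in> hearts n lam" and "H' \<in> hearts n lam"
    and "H (n-1, 2) = H' (n-1, 2)"
    and "H (n-2, 1) = H' (n-2, 1)"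
  shows "card (patterns_with_heart n lam H) = card (patterns_with_heart n lam H')"
proof -
  have "H \<in> hearts 4 lam" "H' \<in> hearts 4 lam" "H (3, 2) = H' (3, 2)" "H (2, 1) = H' (2, 1)"
    using assms by simp_all
  then show ?thesis
    unfolding \<open>n = 4\<close> by (intro order_antisym card_patterns_with_heart_le) simp_all
qed

end
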